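(* Let $(X,\sigma)$ and $(X,\tau)$ be the two $4$-variable dynamical systems on $X=\Delta^{S_4}_{(2)}\sqcup Z$ constructed in the context. Then $(X,\sigma)$ and $(X,\tau)$ are piecewise equivalent but not unitarily equivalent.
   Context: Simplices. Let $S_4$ be the symmetric group on $\{1,2,3,4\}$ with a fixed total order. $\Delta^{S_4}$ is the simplex with vertices indexed by $S_4$; points are $x=\sum_{g\in S_4}x_g g$ with $x_g\ge0$, $\sum_gx_g=1$. For $g_0<\dots<g_l$, $\Delta^{g_0,\dots,g_l}$ is the subsimplex spanned by $g_0,\dots,g_l$, and $\mathcal{P}(\Delta^{g_0,\dots,g_l})$ is the partition of $\{1,2,3,4\}$ into orbits of the group generated by $g_0^{-1}g_1,\dots,g_0^{-1}g_l$ (singletons if $l=0$). The $2$-skeleton $\Delta^{S_4}_{(2)}$ is the union of all $2$-subsimplices. For a partition $\mathcal{P}$, $i\sim_{\mathcal{P}}j$ means $i,j$ are in the same block. Domains. For $g\in S_4$ put $V_g=\{x\in\Delta^{S_4}_{(2)}:x_g>\tfrac14\}$, and for $g_0<\dots<g_l$ put $D_{g_0,\dots,g_l}=\{x\in\Delta^{S_4}_{(2)}:x_{g_i}\ge\tfrac14\text{ for all }0\le i\le l\}$. The sets $V_g$ form an open cover of $\Delta^{S_4}_{(2)}$. The space $Z$. On $\Delta^{S_4}_{(2)}\times\{1,2,3,4\}$ let $(x,i)\sim(y,j)$ iff $x=y$ and there exist $g_0<\dots<g_l$ with $x\in D_{g_0,\dots,g_l}$ and $i\sim_{\mathcal{P}(\Delta^{g_0,\dots,g_l})}j$.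 This is a closed equivalence relation; let $Z$ be the (compact metrizable) quotient space and $[x,i]$ the class of $(x,i)$. The systems. Define $\tilde\sigma_i\colon\Delta^{S_4}_{(2)}\to Z$ by $\tilde\sigma_i(x)=[x,i]$, and $\tilde\tau_i\colon\Delta^{S_4}_{(2)}\to Z$ by $\tilde\tau_i(x)=[x,g^{-1}(i)]$ for $x\in V_g$ (this is well defined and continuous). Let $X=\Delta^{S_4}_{(2)}\sqcup Z$ and define $\sigma_i,\tau_i\colon X\to X$, $i=1,\dots,4$, by $\sigma_i|_{\Delta^{S_4}_{(2)}}=\tilde\sigma_i$, $\tau_i|_{\Delta^{S_4}_{(2)}}=\tilde\tau_i$, and $\sigma_i|_Z=\tau_i|_Z\equiv e$, the constant map to the vertex $e\in\Delta^{S_4}_{(2)}$ given by the identity of $S_4$. Equivalences. Two $n$-variable systems $(X,\sigma)$, $(X,\tau)$ are piecewise equivalent if there is an open cover $\{W_g\}_{g\in S_n}$ of $X$ with $\tau_i|_{W_g}=\sigma_{g^{-1}(i)}|_{W_g}$ for all $i$ and $g$. They are unitarily equivalent if there is a continuous map $u\colon X\to\mathrm{U}(n)$ such that for all $x,i,j$: $u_{ij}(x)\ne0\implies\tau_i(x)=\sigma_j(x)$. *)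

theory Defs
  imports "HOL-Analysis.Analysis" "HOL-Combinatorics.Perm" "HOL-Algebra.Generated_Groups"
begin

unbundle permutation_syntax

section \<open>Quotient and disjoint sum topologies\<close>

definition quotient_topology :: "'a topology \<Rightarrow> ('a \<Rightarrow> 'b) \<Rightarrow> 'b topology" where
  "quotient_topology X p =
     topology (\<lambda>U. U \<subseteq> p ` topspace X \<and> openin X {x \<in> topspace X. p x \<in> U})"

lemma openin_quotient_topology:
  "openin (quotient_topology X p) U \<longleftrightarrow>
     U \<subseteq> p ` topspace X \<and> openin X {x \<in> topspace X. p x \<in> U}"
proof -
  have "{x \<in> topspace X. p x \<in> S \<inter> T} = {x \<in> topspace X. p x \<in> S} \<inter> {x \<in> topspace X. p x \<in> T}"
    for S T by auto
  moreover have "{x \<in> topspace X. p x \<in> \<Union>K} = (\<Union>S\<in>K. {x \<in> topspace X. p x \<in> S})" for K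
    by auto
  ultimately have "istopology (\<lambda>U. U \<subseteq> p ` topspace X \<and> openin X {x \<in> topspace X. p x \<in> U})"
    unfolding istopology_def by (simp add: Sup_le_iff le_infI1 openin_Int, force)
  then show ?thesis
    by (simp add: quotient_topology_def)
qed

lemma topspace_quotient_topology [simp]: "topspace (quotient_topology X p) = p ` topspace X"
proof (rule subset_antisym)
  show "topspace (quotient_topology X p) \<subseteq> p ` topspace X"
    by (metis openin_quotient_topology openin_topspace)
  have "{x \<in> topspace X. p x \<in> p ` topspace X} = topspace X"
    by auto
  then have "openin (quotient_topology X p) (p ` topspace X)"
    by (simp add: openin_quotient_topology)
  then show "p ` topspace X \<subseteq> topspace (quotient_topology X p)"
    by (rule openin_subset)
qed

lemma quotient_map_quotient_topology: "quotient_map X (quotient_topology X p) p"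
  by (auto simp: quotient_map_def openin_quotient_topology)

text \<open>The library's \<open>sum_topology\<close> requires all summands to have the same type of points.\<close>

definition binary_sum_topology :: "'a topology \<Rightarrow> 'b topology \<Rightarrow> ('a + 'b) topology" where
  "binary_sum_topology X Y =
     topology (\<lambda>U. U \<subseteq> topspace X <+> topspace Y \<and> openin X (Inl -` U) \<and> openin Y (Inr -` U))"

lemma openin_binary_sum_topology:
  "openin (binary_sum_topology X Y) U \<longleftrightarrow>
     U \<subseteq> topspace X <+> topspace Y \<and> openin X (Inl -` U) \<and> openin Y (Inr -` U)"
proof -
  have "istopology (\<lambda>U. U \<subseteq> topspace X <+> topspace Y \<and> openin X (Inl -` U) \<and> openin Y (Inr -` U))"
    unfolding istopology_def by (simp add: Sup_le_iff le_infI1 openin_Int vimage_Union, force)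
  then show ?thesis
    by (simp add: binary_sum_topology_def)
qed

lemma topspace_binary_sum_topology [simp]:
  "topspace (binary_sum_topology X Y) = topspace X <+> topspace Y"
proof (rule subset_antisym)
  show "topspace (binary_sum_topology X Y) \<subseteq> topspace X <+> topspace Y"
    by (metis openin_binary_sum_topology openin_topspace)
  have "Inl -` (topspace X <+> topspace Y) = topspace X"
    "Inr -` (topspace X <+> topspace Y) = topspace Y"
    by auto
  then have "openin (binary_sum_topology X Y) (topspace X <+> topspace Y)"
    by (simp add: openin_binary_sum_topology)
  then show "topspace X <+> topspace Y \<subseteq> topspace (binary_sum_topology X Y)"
    by (rule openin_subset)
qed


section \<open>Multivariable dynamical systems and their equivalences\<close>

text \<open>
  The variables of an \<open>n\<close>-variable system are indexed by a finite type with \<open>n\<close> elements; over such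
  a type, \<^typ>\<open>'n perm\<close> is the full symmetric group. In particular \<^typ>\<open>4\<close> serves as
  \<open>{1, 2, 3, 4}\<close>, where the numeral \<open>4\<close> coincides with \<open>0\<close>.
\<close>

definition piecewise_equivalent ::
  "'a topology \<Rightarrow> ('n::finite \<Rightarrow> 'a \<Rightarrow> 'a) \<Rightarrow> ('n \<Rightarrow> 'a \<Rightarrow> 'a) \<Rightarrow> bool" where
  "piecewise_equivalent X \<sigma> \<tau> \<longleftrightarrow>
     (\<exists>W :: 'n perm \<Rightarrow> 'a set.
        (\<forall>g. openin X (W g)) \<and> (\<Union>g. W g) = topspace X \<and>
        (\<forall>i g. \<forall>x \<in> W g. \<tau> i x = \<sigma> (inverse g \<langle>$\<rangle> i) x))"

definition adjoint_matrix :: "complex ^ 'n ^ 'n \<Rightarrow> complex ^ 'n ^ 'n" where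
  "adjoint_matrix A = (\<chi> i j. cnj (A $ j $ i))"

definition unitary_matrices :: "(complex ^ 'n ^ 'n) set" where
  "unitary_matrices = {A. A ** adjoint_matrix A = mat 1 \<and> adjoint_matrix A ** A = mat 1}"

definition unitarily_equivalent ::
  "'a topology \<Rightarrow> ('n::finite \<Rightarrow> 'a \<Rightarrow> 'a) \<Rightarrow> ('n \<Rightarrow> 'a \<Rightarrow> 'a) \<Rightarrow> bool" where
  "unitarily_equivalent X \<sigma> \<tau> \<longleftrightarrow>
     (\<exists>u :: 'a \<Rightarrow> complex ^ 'n ^ 'n.
        continuous_map X (top_of_set unitary_matrices) u \<and>
        (\<forall>x \<in> topspace X. \<forall>i j. u x $ i $ j \<noteq> 0 \<longrightarrow> \<tau> i x = \<sigma> j x))"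


section \<open>The simplex on the symmetric group\<close>

type_synonym S4 = "4 perm"

type_synonym point = "S4 \<Rightarrow> real"

text \<open>
  The relation \<open>r\<close> below is the fixed total order on the symmetric group, and a sequence
  \<open>g\<^sub>0 < \<dots> < g\<^sub>l\<close> is a non-empty list that is strictly increasing for \<open>r\<close>.
\<close>

definition chain :: "S4 rel \<Rightarrow> S4 list \<Rightarrow> bool" where
  "chain r gs \<longleftrightarrow> gs \<noteq> [] \<and> sorted_wrt (\<lambda>g h. (g, h) \<in> r \<and> g \<noteq> h) gs"

definition S4_simplex :: "point set" where
  "S4_simplex = {x. (\<forall>g. 0 \<le> x g) \<and> (\<Sum>g\<in>UNIV. x g) = 1}"

definition subsimplex :: "S4 list \<Rightarrow> point set" where
  "subsimplex gs = {x \<in> S4_simplex. \<forall>g. g \<notin> set gs \<longrightarrow> x g = 0}"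

definition skeleton2 :: "S4 rel \<Rightarrow> point set" where
  "skeleton2 r = \<Union> {subsimplex gs |gs. chain r gs \<and> length gs = 3}"

definition vertex :: "S4 \<Rightarrow> point" where
  "vertex g = (\<lambda>h. if h = g then 1 else 0)"

definition S4_group :: "S4 monoid" where
  "S4_group = \<lparr>carrier = UNIV, mult = (*), one = 1\<rparr>"

definition orbit_partition :: "S4 list \<Rightarrow> 4 set set" where
  "orbit_partition gs =
     (let H = generate S4_group ((\<lambda>g. inverse (hd gs) * g) ` set (tl gs))
      in {{h \<langle>$\<rangle> i |h. h \<in> H} |i. True})"

definition same_block :: "'a set set \<Rightarrow> 'a \<Rightarrow> 'a \<Rightarrow> bool" where
  "same_block P i j \<longleftrightarrow> (\<exists>B\<in>P. i \<in> B \<and> j \<in> B)"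

definition V_domain :: "S4 rel \<Rightarrow> S4 \<Rightarrow> point set" where
  "V_domain r g = {x \<in> skeleton2 r. x g > 1/4}"

definition D_domain :: "S4 rel \<Rightarrow> S4 list \<Rightarrow> point set" where
  "D_domain r gs = {x \<in> skeleton2 r. \<forall>g \<in> set gs. x g \<ge> 1/4}"


section \<open>The space \<open>Z\<close> and the two systems\<close>

definition glue :: "S4 rel \<Rightarrow> (point \<times> 4) rel" where
  "glue r = {((x, i), (y, j)). x \<in> skeleton2 r \<and> x = y \<and>
     (\<exists>gs. chain r gs \<and> x \<in> D_domain r gs \<and> same_block (orbit_partition gs) i j)}"

definition cls :: "S4 rel \<Rightarrow> point \<Rightarrow> 4 \<Rightarrow> (point \<times> 4) set" where
  "cls r x i = glue r `` {(x, i)}"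

definition Z_space :: "S4 rel \<Rightarrow> (point \<times> 4) set topology" where
  "Z_space r =
     quotient_topology (prod_topology (top_of_set (skeleton2 r)) (discrete_topology UNIV))
       (\<lambda>(x, i). cls r x i)"

type_synonym X_point = "point + (point \<times> 4) set"

definition X_space :: "S4 rel \<Rightarrow> X_point topology" where
  "X_space r = binary_sum_topology (top_of_set (skeleton2 r)) (Z_space r)"

definition sigma_tilde :: "S4 rel \<Rightarrow> 4 \<Rightarrow> point \<Rightarrow> (point \<times> 4) set" where
  "sigma_tilde r i x = cls r x i"

text \<open>
  On the \<open>2\<close>-skeleton some coordinate is at least \<open>1/3\<close>, so the sets \<open>V_domain r g\<close> cover it, and
  the class below does not depend on the choice of \<open>g\<close>.
\<close>

definition tau_tilde :: "S4 rel \<Rightarrow> 4 \<Rightarrow> point \<Rightarrow> (point \<times> 4) set" where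
  "tau_tilde r i x = (THE z. \<exists>g. x \<in> V_domain r g \<and> z = cls r x (inverse g \<langle>$\<rangle> i))"

definition system_sigma :: "S4 rel \<Rightarrow> 4 \<Rightarrow> X_point \<Rightarrow> X_point" where
  "system_sigma r i = case_sum (\<lambda>x. Inr (sigma_tilde r i x)) (\<lambda>z. Inl (vertex 1))"

definition system_tau :: "S4 rel \<Rightarrow> 4 \<Rightarrow> X_point \<Rightarrow> X_point" where
  "system_tau r i = case_sum (\<lambda>x. Inr (tau_tilde r i x)) (\<lambda>z. Inl (vertex 1))"

end

theory Submission
  imports Defs
begin

text \<open>
  Two points \<open>(x, i)\<close> and \<open>(x, j)\<close> are glued exactly if \<open>i\<close> and \<open>j\<close> lie in one orbit of the group
  generated by the differences \<open>g\<inverse>h\<close>, where \<open>g\<close> and \<open>h\<close> run over the coordinates of \<open>x\<close> that are at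
  least \<open>1/4\<close> (\<open>cls_eq_iff\<close>). Hence \<open>\<tau>\<close> is well defined, and the sets where a coordinate exceeds
  \<open>1/4\<close>, each enlarged by \<open>Z\<close>, witness piecewise equivalence.

  Suppose that \<open>u\<close> is a unitary equivalence and let \<open>U\<close> be its restriction to the \<open>2\<close>-skeleton. If
  all permutations spanning a face send the set of columns \<open>B\<close> to the set of rows \<open>B'\<close>, then on
  this face \<open>U\<close> splits into the blocks \<open>B' \<times> B\<close> and \<open>-B' \<times> -B\<close>. In particular \<open>U\<close> is monomial with
  pattern \<open>h\<close> at the vertex \<open>h\<close>, the entry \<open>(i, j)\<close> has no zero on the face of all \<open>h\<close> with
  \<open>h(j) = i\<close>, and the two complementary \<open>2 \<times> 2\<close> minors have no zero on the face of all \<open>h\<close> that send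
  \<open>{j, k}\<close> to a given set. Here and below, only the \<open>2\<close>-skeleton of each face is meant.

  A function without zeros on the \<open>2\<close>-skeleton of a simplex has square roots at the vertices that
  correspond under continuation along all edges, because triangles are contractible
  (\<open>sqrt_potential\<close>). Choose such roots \<open>Q\<close> for the determinant and \<open>p\<^sub>j\<close> for the entry \<open>(h(j), j)\<close>,
  and put \<open>\<epsilon>(h) = Q(h) / \<Prod>\<^sub>j p\<^sub>j(h)\<close>. Then \<open>\<epsilon>(h)\<^sup>2\<close> is the sign of \<open>h\<close>. For disjoint transpositions
  \<open>a\<close>, \<open>b\<close> the coset \<open>{g, ga, gb, gab}\<close> spans a face on which the determinant is, up to sign, a
  product of two minors, and comparing square roots of the minors with those of the entries gives
  \<open>\<epsilon>(g) \<epsilon>(gab) = \<epsilon>(ga) \<epsilon>(gb)\<close> (\<open>normalized_root_square\<close>).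

  No such \<open>\<epsilon>\<close> exists (\<open>no_square_compatible_root_of_sign\<close>). After multiplication by \<open>\<i>\<close> on the odd
  permutations its values are \<open>\<plusminus>1\<close> and its product over each of these cosets is \<open>-1\<close>; but there are
  nine such cosets that together cover every permutation an even number of times.
\<close>

section \<open>Permutations\<close>

lemma finite_perms: "finite (UNIV :: 'a::finite perm set)"
proof (rule finite_imageD)
  show "finite (apply ` (UNIV :: 'a perm set))" by simp
  show "inj_on apply (UNIV :: 'a perm set)" by (simp add: inj_on_def apply_inject)
qed

lemma apply_mult: "(g * h) \<langle>$\<rangle> i = g \<langle>$\<rangle> (h \<langle>$\<rangle> i)"
  by (simp add: apply_times)

lemma apply_inverse_cancel: "inverse g \<langle>$\<rangle> (g \<langle>$\<rangle> i) = i" "g \<langle>$\<rangle> (inverse g \<langle>$\<rangle> i) = i"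
  by (simp_all flip: apply_mult)

lemma apply_image_eq_iff: "g \<langle>$\<rangle> i \<in> (apply g) ` B \<longleftrightarrow> i \<in> B"
  by (auto simp: apply_inj)

section \<open>The gluing as orbits of difference groups\<close>

lemma group_S4: "group S4_group"
proof (rule groupI)
  show "\<exists>h\<in>carrier S4_group. h \<otimes>\<^bsub>S4_group\<^esub> g = \<one>\<^bsub>S4_group\<^esub>" for g
    by (intro bexI[of _ "inverse g"]) (simp_all add: S4_group_def)
qed (simp_all add: S4_group_def mult.assoc)

lemma S4_group_simps [simp]:
  "carrier S4_group = UNIV" "mult S4_group = (*)" "one S4_group = 1"
  by (simp_all add: S4_group_def)

lemma inv_S4_group [simp]: "m_inv S4_group g = inverse g"
  by (rule group.inv_equality[OF group_S4]) auto

text \<open>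
  Using the differences of all pairs makes the group monotone in the set and independent of the
  total order.
\<close>

definition difference_group :: "S4 set \<Rightarrow> S4 set" where
  "difference_group A = generate S4_group {inverse g * h |g h. g \<in> A \<and> h \<in> A}"

lemma difference_group_subgroup: "subgroup (difference_group A) S4_group"
  unfolding difference_group_def by (rule group.generate_is_subgroup[OF group_S4]) simp

lemma difference_group_closed:
  "1 \<in> difference_group A"
  "g \<in> difference_group A \<Longrightarrow> h \<in> difference_group A \<Longrightarrow> g * h \<in> difference_group A"
  "g \<in> difference_group A \<Longrightarrow> inverse g \<in> difference_group A"
  using subgroup.one_closed[OF difference_group_subgroup[of A]]
    subgroup.m_closed[OF difference_group_subgroup[of A]]
    subgroup.m_inv_closed[OF difference_group_subgroup[of A]]
  by simp_all

text \<open>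
  \<open>g\<inverse>h\<close> is the quotient of the differences of \<open>h\<close> and of \<open>g\<close> with the first element, so the
  choice of a first element does not matter.
\<close>

lemma generate_first_differences:
  assumes "gs \<noteq> []"
  shows "generate S4_group ((\<lambda>g. inverse (hd gs) * g) ` set (tl gs)) = difference_group (set gs)"
    (is "?H = _")
proof
  show "?H \<subseteq> difference_group (set gs)"
    unfolding difference_group_def using assms
    by (intro group.mono_generate[OF group_S4]) (cases gs; auto)
  have H: "subgroup ?H S4_group"
    by (rule group.generate_is_subgroup[OF group_S4]) simp
  have first: "inverse (hd gs) * g \<in> ?H" if "g \<in> set gs" for g
  proof (cases "g = hd gs")
    case True
    then show ?thesis using subgroup.one_closed[OF H] by simp
  next
    case False
    with that assms have "g \<in> set (tl gs)" by (cases gs) auto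
    then show ?thesis by (auto intro!: generate.incl)
  qed
  have "inverse g * h \<in> ?H" if "g \<in> set gs" "h \<in> set gs" for g h
  proof -
    have "inverse (inverse (hd gs) * g) * (inverse (hd gs) * h) \<in> ?H"
      using subgroup.m_closed[OF H subgroup.m_inv_closed[OF H first[OF that(1)]] first[OF that(2)]]
      by simp
    moreover have "inverse (inverse (hd gs) * g) * (inverse (hd gs) * h) = inverse g * h"
      by (rule perm_eqI) (simp only: apply_mult apply_inverse_cancel perm.inverse_distrib_swap perm.inverse_inverse)
    ultimately show ?thesis by simp
  qed
  then show "difference_group (set gs) \<subseteq> ?H"
    unfolding difference_group_def
    by (intro group.generate_subgroup_incl[OF group_S4 _ H]) auto
qed

lemma same_block_orbit_partition:
  assumes "gs \<noteq> []"
  shows "same_block (orbit_partition gs) i j \<longleftrightarrow>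
    (\<exists>k \<in> difference_group (set gs). k \<langle>$\<rangle> i = j)"
proof
  assume "same_block (orbit_partition gs) i j"
  then obtain B where B: "B \<in> orbit_partition gs" "i \<in> B" "j \<in> B"
    by (auto simp: same_block_def)
  then obtain a where "B = {h \<langle>$\<rangle> a |h. h \<in> difference_group (set gs)}"
    by (auto simp: orbit_partition_def Let_def generate_first_differences[OF assms])
  with B obtain h h' where "h \<in> difference_group (set gs)" "h' \<in> difference_group (set gs)"
    and "i = h \<langle>$\<rangle> a" "j = h' \<langle>$\<rangle> a"
    by auto
  then show "\<exists>k \<in> difference_group (set gs). k \<langle>$\<rangle> i = j"
    by (intro bexI[of _ "h' * inverse h"])
      (auto simp: apply_mult apply_inverse_cancel intro: difference_group_closed)
next
  assume "\<exists>k \<in> difference_group (set gs). k \<langle>$\<rangle> i = j"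
  then obtain k where k: "k \<in> difference_group (set gs)" "k \<langle>$\<rangle> i = j" by blast
  let ?B = "{h \<langle>$\<rangle> i |h. h \<in> difference_group (set gs)}"
  have "?B \<in> orbit_partition gs"
    unfolding orbit_partition_def Let_def generate_first_differences[OF assms] by (rule CollectI) auto
  moreover have "i \<in> ?B"
    using difference_group_closed(1)[of "set gs"] by (intro CollectI exI[of _ 1]) simp
  moreover have "j \<in> ?B" by (rule CollectI) (use k in auto)
  ultimately show "same_block (orbit_partition gs) i j"
    unfolding same_block_def by (intro bexI[of _ ?B] conjI)
qed

lemma difference_group_mono: "A \<subseteq> B \<Longrightarrow> difference_group A \<subseteq> difference_group B"
  unfolding difference_group_def by (intro group.mono_generate[OF group_S4]) auto

lemma ex_chain:
  assumes "linear_order r" "A \<noteq> {}"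
  shows "\<exists>gs. chain r gs \<and> set gs = A \<and> length gs = card A"
proof -
  have r: "(g, g) \<in> r" "(g, h) \<in> r \<Longrightarrow> (h, k) \<in> r \<Longrightarrow> (g, k) \<in> r"
    "(g, h) \<in> r \<Longrightarrow> (h, g) \<in> r \<Longrightarrow> g = h" "(g, h) \<in> r \<or> (h, g) \<in> r" for g h k
    using assms(1)
    unfolding linear_order_on_def partial_order_on_def preorder_on_def
    by (auto dest: refl_onD transD antisymD simp: total_on_def) (metis UNIV_I refl_onD)
  interpret linorder "\<lambda>g h. (g, h) \<in> r" "\<lambda>g h. (g, h) \<in> r \<and> g \<noteq> h"
  proof
    fix g h k
    show "((g, h) \<in> r \<and> g \<noteq> h) = ((g, h) \<in> r \<and> (h, g) \<notin> r)" using r by metis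
  qed (fact r)+
  have "finite A" by (rule finite_subset[OF _ finite_perms]) simp
  then have "set (sorted_list_of_set A) = A" "length (sorted_list_of_set A) = card A"
    by simp_all
  moreover from this assms(2) have "chain r (sorted_list_of_set A)"
    using strict_sorted_list_of_set[of A] by (auto simp: chain_def)
  ultimately show ?thesis by (intro exI conjI)
qed

text \<open>
  Among all chains \<open>gs\<close> with \<open>x \<in> D_domain r gs\<close> the one that lists \<open>heavy x\<close> has the coarsest
  partition; it alone decides how the fibre over \<open>x\<close> is glued.
\<close>

definition heavy :: "point \<Rightarrow> S4 set" where
  "heavy x = {g. 1/4 \<le> x g}"

text \<open>Every set of three permutations is listed by a chain, so the skeleton does not depend on the order.\<close>

lemma skeleton2_iff:
  assumes "linear_order r"
  shows "x \<in> skeleton2 r \<longleftrightarrow> x \<in> S4_simplex \<and> (\<exists>A. card A = 3 \<and> (\<forall>g. x g \<noteq> 0 \<longrightarrow> g \<in> A))"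
proof
  assume "x \<in> skeleton2 r"
  then obtain gs where gs: "chain r gs" "length gs = 3" "x \<in> subsimplex gs"
    by (auto simp: skeleton2_def)
  have "sorted_wrt (\<noteq>) gs"
    using gs(1) sorted_wrt_mono_rel[of gs "\<lambda>g h. (g, h) \<in> r \<and> g \<noteq> h" "(\<noteq>)"]
    by (simp add: chain_def)
  then have "distinct gs" by (induction gs) auto
  then have "card (set gs) = 3" using gs(2) by (simp add: distinct_card)
  then show "x \<in> S4_simplex \<and> (\<exists>A. card A = 3 \<and> (\<forall>g. x g \<noteq> 0 \<longrightarrow> g \<in> A))"
    using gs(3) by (auto simp: subsimplex_def intro!: exI[of _ "set gs"])
next
  assume R: "x \<in> S4_simplex \<and> (\<exists>A. card A = 3 \<and> (\<forall>g. x g \<noteq> 0 \<longrightarrow> g \<in> A))"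
  then obtain A where A: "card A = 3" "\<forall>g. x g \<noteq> 0 \<longrightarrow> g \<in> A" by blast
  then have "A \<noteq> {}" by auto
  then obtain gs where "chain r gs" "set gs = A" "length gs = 3"
    using ex_chain[OF assms, of A] A by auto
  moreover from this have "x \<in> subsimplex gs" using R A(2) by (auto simp: subsimplex_def)
  ultimately show "x \<in> skeleton2 r"
    unfolding skeleton2_def by (intro UnionI[of "subsimplex gs"] CollectI exI[of _ gs] conjI refl)
qed

text \<open>At most three coordinates are non-zero, and three numbers of at most \<open>1/4\<close> cannot add up to \<open>1\<close>.\<close>

lemma ex_large_coordinate:
  assumes "linear_order r" "x \<in> skeleton2 r"
  shows "\<exists>g. 1/4 < x g"
proof (rule ccontr)
  assume neg: "\<not> (\<exists>g. 1/4 < x g)"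
  obtain A where A: "card A = 3" "\<forall>g. x g \<noteq> 0 \<longrightarrow> g \<in> A" and x: "x \<in> S4_simplex"
    using assms skeleton2_iff by blast
  have "1 = (\<Sum>g\<in>UNIV. x g)" using x by (simp add: S4_simplex_def)
  also have "\<dots> = (\<Sum>g\<in>A. x g)"
    using A(2) by (intro sum.mono_neutral_right finite_perms) auto
  also have "\<dots> \<le> (\<Sum>g\<in>A. 1/4)" using neg by (intro sum_mono) (simp add: not_less)
  also have "\<dots> = 3/4" using A(1) by simp
  finally show False by simp
qed

lemma glue_iff:
  assumes "linear_order r" "x \<in> skeleton2 r"
  shows "((x, i), (y, j)) \<in> glue r \<longleftrightarrow> y = x \<and> (\<exists>k \<in> difference_group (heavy x). k \<langle>$\<rangle> i = j)"
proof
  assume "((x, i), (y, j)) \<in> glue r"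
  then obtain gs where gs: "chain r gs" "x \<in> D_domain r gs" "same_block (orbit_partition gs) i j"
    and "x = y" unfolding glue_def by blast
  then have "set gs \<subseteq> heavy x" by (auto simp: D_domain_def heavy_def)
  moreover have "gs \<noteq> []" using gs(1) by (simp add: chain_def)
  ultimately show "y = x \<and> (\<exists>k \<in> difference_group (heavy x). k \<langle>$\<rangle> i = j)"
    using gs(3) \<open>x = y\<close> difference_group_mono[of "set gs" "heavy x"]
    by (auto simp: same_block_orbit_partition)
next
  assume R: "y = x \<and> (\<exists>k \<in> difference_group (heavy x). k \<langle>$\<rangle> i = j)"
  have "heavy x \<noteq> {}" using ex_large_coordinate[OF assms] by (auto simp: heavy_def intro: less_imp_le)
  then obtain gs where gs: "chain r gs" "set gs = heavy x" using ex_chain[OF assms(1)] by blast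
  then have "same_block (orbit_partition gs) i j"
    using R same_block_orbit_partition[of gs i j] by (auto simp: chain_def)
  moreover have "x \<in> D_domain r gs" using gs(2) assms(2) by (simp add: D_domain_def heavy_def)
  ultimately show "((x, i), (y, j)) \<in> glue r"
    using R assms(2) gs(1) by (auto simp: glue_def)
qed

lemma cls_eq_iff:
  assumes "linear_order r" "x \<in> skeleton2 r"
  shows "cls r x i = cls r x j \<longleftrightarrow> (\<exists>k \<in> difference_group (heavy x). k \<langle>$\<rangle> i = j)"
proof -
  let ?G = "difference_group (heavy x)"
  have cls: "cls r x i = {(x, k \<langle>$\<rangle> i) |k. k \<in> ?G}" for i
    using glue_iff[OF assms] by (auto simp: cls_def)
  have sub: "cls r x (k \<langle>$\<rangle> i) \<subseteq> cls r x i" if "k \<in> ?G" for k i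
    unfolding cls using difference_group_closed(2)[OF _ that]
    by (auto simp flip: apply_mult)
  have "cls r x i = cls r x (k \<langle>$\<rangle> i)" if "k \<in> ?G" for k
    using sub[OF that, of i] sub[OF difference_group_closed(3)[OF that], of "k \<langle>$\<rangle> i"]
    by (simp add: apply_inverse_cancel)
  moreover have "(x, j) \<in> cls r x j"
    unfolding cls using difference_group_closed(1)[of "heavy x"]
    by (intro CollectI exI[of _ 1]) simp
  then have "\<exists>k \<in> ?G. k \<langle>$\<rangle> i = j" if "cls r x i = cls r x j"
  proof -
    have "(x, j) \<in> cls r x i" using \<open>(x, j) \<in> cls r x j\<close> that by simp
    then show ?thesis unfolding cls by auto
  qed
  ultimately show ?thesis by auto
qed

section \<open>Piecewise equivalence\<close>

text \<open>
  If the coordinates of \<open>g\<close> and \<open>h\<close> both exceed \<open>1/4\<close>, the difference \<open>g\<inverse>h\<close> moves \<open>h\<inverse>(i)\<close> to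
  \<open>g\<inverse>(i)\<close>, so the gluing makes the two candidate values equal.
\<close>

lemma tau_tilde_eq:
  assumes "linear_order r" "x \<in> V_domain r g"
  shows "tau_tilde r i x = cls r x (inverse g \<langle>$\<rangle> i)"
  unfolding tau_tilde_def
proof (rule the_equality)
  show "\<exists>h. x \<in> V_domain r h \<and> cls r x (inverse g \<langle>$\<rangle> i) = cls r x (inverse h \<langle>$\<rangle> i)"
    using assms(2) by blast
next
  fix z assume "\<exists>h. x \<in> V_domain r h \<and> z = cls r x (inverse h \<langle>$\<rangle> i)"
  then obtain h where h: "x \<in> V_domain r h" and z: "z = cls r x (inverse h \<langle>$\<rangle> i)" by blast
  have "inverse g * h \<in> difference_group (heavy x)"
    unfolding difference_group_def
    using h assms(2) by (intro generate.incl) (auto simp: V_domain_def heavy_def intro: less_imp_le)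
  moreover have "(inverse g * h) \<langle>$\<rangle> (inverse h \<langle>$\<rangle> i) = inverse g \<langle>$\<rangle> i"
    by (simp add: apply_mult apply_inverse_cancel)
  ultimately show "z = cls r x (inverse g \<langle>$\<rangle> i)"
    unfolding z using assms by (subst cls_eq_iff) (auto simp: V_domain_def)
qed

text \<open>On \<open>Z\<close> all maps of both systems are the same constant, so \<open>Z\<close> can be added to every piece.\<close>

lemma piecewise_equivalent_systems:
  assumes "linear_order r"
  shows "piecewise_equivalent (X_space r) (system_sigma r) (system_tau r)"
  unfolding piecewise_equivalent_def
proof (intro exI conjI allI ballI)
  let ?W = "\<lambda>g. V_domain r g <+> topspace (Z_space r)"
  show "openin (X_space r) (?W g)" for g
  proof -
    have "open {x :: point. 1/4 < x g}"
      by (intro open_Collect_less continuous_intros continuous_on_product_coordinates)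
    moreover have "V_domain r g = skeleton2 r \<inter> {x. 1/4 < x g}"
      by (auto simp: V_domain_def)
    ultimately have "openin (top_of_set (skeleton2 r)) (V_domain r g)"
      by (simp add: openin_open_Int)
    moreover have "Inl -` ?W g = V_domain r g" "Inr -` ?W g = topspace (Z_space r)" by auto
    moreover have "?W g \<subseteq> skeleton2 r <+> topspace (Z_space r)" by (auto simp: V_domain_def)
    ultimately show ?thesis
      by (simp add: X_space_def openin_binary_sum_topology)
  qed
  show "(\<Union>g. ?W g) = topspace (X_space r)"
    using ex_large_coordinate[OF assms]
    by (fastforce simp: X_space_def V_domain_def)
  show "system_tau r i x = system_sigma r (inverse g \<langle>$\<rangle> i) x" if "x \<in> ?W g" for i g x
    using that tau_tilde_eq[OF assms]
    by (auto simp: system_tau_def system_sigma_def sigma_tilde_def)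
qed

section \<open>Square roots along edges\<close>

text \<open>
  Continuing a square root of \<open>f\<close> continuously along the unit interval turns the value \<open>a\<close> at \<open>0\<close>
  into the value \<open>b\<close> at \<open>1\<close>.
\<close>

definition sqrt_transport :: "(real \<Rightarrow> complex) \<Rightarrow> complex \<Rightarrow> complex \<Rightarrow> bool" where
  "sqrt_transport f a b \<longleftrightarrow>
     (\<exists>s. continuous_on {0..1} s \<and> (\<forall>t\<in>{0..1}. (s t)\<^sup>2 = f t) \<and> s 0 = a \<and> s 1 = b)"

lemma sqrt_transport_start: "sqrt_transport f a b \<Longrightarrow> a\<^sup>2 = f 0"
  by (force simp: sqrt_transport_def)

lemma sqrt_transport_mult:
  assumes "sqrt_transport f a b" "sqrt_transport f' a' b'"
  shows "sqrt_transport (\<lambda>t. f t * f' t) (a * a') (b * b')"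
proof -
  obtain s s' where "continuous_on {0..1} s" "\<forall>t\<in>{0..1}. (s t)\<^sup>2 = f t" "s 0 = a" "s 1 = b"
    and "continuous_on {0..1} s'" "\<forall>t\<in>{0..1}. (s' t)\<^sup>2 = f' t" "s' 0 = a'" "s' 1 = b'"
    using assms unfolding sqrt_transport_def by metis
  then show ?thesis
    unfolding sqrt_transport_def
    by (intro exI[of _ "\<lambda>t. s t * s' t"] conjI continuous_intros)
      (auto simp: power_mult_distrib)
qed

text \<open>
  The quotient of the two continued roots is a continuous square root of the constant \<open>\<kappa>\<close>. It
  takes at most two values, hence only one.
\<close>

lemma sqrt_transport_proportional:
  assumes "sqrt_transport f a b" "sqrt_transport f' a' b'"
    and scale: "\<And>t. t \<in> {0..1} \<Longrightarrow> f' t = \<kappa> * f t" and nz: "\<And>t. t \<in> {0..1} \<Longrightarrow> f t \<noteq> 0"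
  shows "a * b' = a' * b"
proof -
  obtain s where s: "continuous_on {0..1} s" "\<And>t. t\<in>{0..1} \<Longrightarrow> (s t)\<^sup>2 = f t" "s 0 = a" "s 1 = b"
    using assms(1) unfolding sqrt_transport_def by metis
  obtain s' where s': "continuous_on {0..1} s'" "\<And>t. t\<in>{0..1} \<Longrightarrow> (s' t)\<^sup>2 = f' t"
    "s' 0 = a'" "s' 1 = b'"
    using assms(2) unfolding sqrt_transport_def by metis
  have nz': "s t \<noteq> 0" if "t \<in> {0..1}" for t using s(2) nz that by fastforce
  let ?q = "\<lambda>t. s' t / s t"
  have cont: "continuous_on {0..1} ?q"
    by (intro continuous_intros s s') (use nz' in auto)
  have "(?q t)\<^sup>2 = (csqrt \<kappa>)\<^sup>2" if "t \<in> {0..1}" for t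
    using s(2)[OF that] s'(2)[OF that] scale[OF that] nz[OF that] by (simp add: power_divide)
  then have "?q t = csqrt \<kappa> \<or> ?q t = - csqrt \<kappa>" if "t \<in> {0..1}" for t
    using that power2_eq_iff by blast
  then have "?q ` {0..1} \<subseteq> {csqrt \<kappa>, - csqrt \<kappa>}" by blast
  then have "finite (?q ` {0..1})" by (rule finite_subset) simp
  then have "?q constant_on {0..1}"
    by (intro continuous_finite_range_constant cont) auto
  then have "?q 0 = ?q 1" unfolding constant_on_def by force
  then show ?thesis
    using s s' nz'[of 0] nz'[of 1] by (simp add: field_simps)
qed

definition edge :: "S4 \<Rightarrow> S4 \<Rightarrow> real \<Rightarrow> point" where
  "edge g h t = (\<lambda>k. (1 - t) * vertex g k + t * vertex h k)"

lemma edge_0 [simp]: "edge g h 0 = vertex g"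
  by (simp add: edge_def)

text \<open>The \<open>2\<close>-skeleton of the face spanned by \<open>A\<close>.\<close>

definition skeleton_on :: "S4 rel \<Rightarrow> S4 set \<Rightarrow> point set" where
  "skeleton_on r A = {x \<in> skeleton2 r. \<forall>g. x g \<noteq> 0 \<longrightarrow> g \<in> A}"

lemma ex_triple:
  assumes "card (A :: S4 set) \<le> 3"
  shows "\<exists>B. A \<subseteq> B \<and> card B = 3"
proof -
  have "card {1, \<langle>1 \<leftrightarrow> 2\<rangle>, \<langle>1 \<leftrightarrow> 3\<rangle> :: S4} = 3"
  proof -
    have "\<langle>1 \<leftrightarrow> 2\<rangle> \<langle>$\<rangle> (1::4) \<noteq> \<langle>1 \<leftrightarrow> 3\<rangle> \<langle>$\<rangle> 1" "\<langle>1 \<leftrightarrow> 2\<rangle> \<langle>$\<rangle> (1::4) \<noteq> 1 \<langle>$\<rangle> 1"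
      "\<langle>1 \<leftrightarrow> 3\<rangle> \<langle>$\<rangle> (1::4) \<noteq> 1 \<langle>$\<rangle> 1"
      by simp_all
    then have "\<langle>1 \<leftrightarrow> 2\<rangle> \<noteq> \<langle>1 \<leftrightarrow> 3::4\<rangle>" "\<langle>1 \<leftrightarrow> 2::4\<rangle> \<noteq> 1" "\<langle>1 \<leftrightarrow> 3::4\<rangle> \<noteq> 1"
      by metis+
    then show ?thesis by auto
  qed
  then have "3 \<le> card (UNIV :: S4 set)"
    by (metis card_mono finite_perms subset_UNIV)
  then show ?thesis
    using exists_subset_between[OF assms _ subset_UNIV finite_perms] by blast
qed

lemma sum_vertex: "(\<Sum>k\<in>UNIV. vertex g k) = 1"
  by (simp add: vertex_def finite_perms)

text \<open>
  The vertices \<open>a\<close>, \<open>b\<close>, \<open>c\<close> may coincide; the points then lie in a face of lower dimension, which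
  still belongs to some \<open>2\<close>-simplex. Edges are treated as degenerate triangles.
\<close>

lemma triangle_in_skeleton:
  assumes "linear_order r" "0 \<le> s" "0 \<le> t" "s + t \<le> 1" "{a, b, c} \<subseteq> A"
  shows "(\<lambda>k. (1 - s - t) * vertex a k + s * vertex b k + t * vertex c k) \<in> skeleton_on r A"
    (is "?x \<in> _")
proof -
  have supp: "k \<in> {a, b, c}" if "?x k \<noteq> 0" for k
    using that by (auto simp: vertex_def split: if_splits)
  have "card {a, b, c} \<le> 3" by (simp add: card_insert_if)
  then obtain B where "{a, b, c} \<subseteq> B" "card B = 3" using ex_triple by blast
  moreover have "(\<Sum>k\<in>UNIV. ?x k) = 1"
    by (simp add: sum.distrib sum_vertex flip: sum_distrib_left)
  then have "?x \<in> S4_simplex"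
    using assms(2-4) by (auto simp: S4_simplex_def vertex_def)
  ultimately have "?x \<in> skeleton2 r"
    using supp by (subst skeleton2_iff[OF assms(1)]) blast
  then show ?thesis using supp assms(5) unfolding skeleton_on_def by blast
qed

lemma edge_in_skeleton:
  assumes "linear_order r" "t \<in> {0..1}" "{g, h} \<subseteq> A"
  shows "edge g h t \<in> skeleton_on r A"
  using triangle_in_skeleton[of r t 0 g h h A] assms by (simp add: edge_def)

text \<open>
  A triangle is contractible, so \<open>f\<close> has a continuous square root on it, and the transports along
  the three sides are restrictions of this one function.
\<close>

lemma sqrt_transport_triangle:
  fixes f :: "point \<Rightarrow> complex"
  assumes lin: "linear_order r" and abc: "{a, b, c} \<subseteq> A"
    and f: "continuous_on (skeleton_on r A) f" "\<And>x. x \<in> skeleton_on r A \<Longrightarrow> f x \<noteq> 0"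
    and \<alpha>: "\<alpha>\<^sup>2 = f (vertex a)"
  shows "\<exists>\<beta> \<gamma>. sqrt_transport (\<lambda>t. f (edge a b t)) \<alpha> \<beta> \<and> sqrt_transport (\<lambda>t. f (edge a c t)) \<alpha> \<gamma> \<and>
    sqrt_transport (\<lambda>t. f (edge b c t)) \<beta> \<gamma>"
proof -
  define T where "T = {(s, t). 0 \<le> s \<and> 0 \<le> t \<and> s + t \<le> (1::real)}"
  define p where "p = (\<lambda>(s, t) k. (1 - s - t) * vertex a k + s * vertex b k + t * vertex c k)"
  have "convex T"
  proof (rule convexI)
    fix x y :: "real \<times> real" and u v :: real
    assume xy: "x \<in> T" "y \<in> T" and uv: "0 \<le> u" "0 \<le> v" "u + v = 1"
    have "u * (fst x + snd x) + v * (fst y + snd y) \<le> u * 1 + v * 1"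
      using xy uv by (intro add_mono mult_left_mono) (auto simp: T_def)
    then show "u *\<^sub>R x + v *\<^sub>R y \<in> T"
      using xy uv by (auto simp: T_def case_prod_beta algebra_simps)
  qed
  then have contr: "contractible T" by (rule convex_imp_contractible)
  have pT: "p z \<in> skeleton_on r A" if "z \<in> T" for z
    using that triangle_in_skeleton[OF lin _ _ _ abc] by (auto simp: p_def T_def)
  have cont_p: "continuous_on T p"
    unfolding p_def case_prod_beta
    by (intro continuous_on_coordinatewise_then_product continuous_intros)
  have "continuous_on T (\<lambda>z. f (p z))"
    by (rule continuous_on_compose2[OF f(1) cont_p]) (use pT in blast)
  then obtain s where s: "continuous_on T s" "\<And>z. z \<in> T \<Longrightarrow> f (p z) = (s z)\<^sup>2"
    using continuous_sqrt_on_contractible[OF _ contr, of "\<lambda>z. f (p z)"] f(2) pT by blast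
  have p0: "p (0, 0) = vertex a" by (simp add: p_def)
  have T0: "(0, 0) \<in> T" by (simp add: T_def)
  have "(s (0, 0))\<^sup>2 = \<alpha>\<^sup>2" using s(2)[OF T0] \<alpha> p0 by simp
  \<comment> \<open>The sign of the root is adjusted to the prescribed value at \<open>a\<close>.\<close>
  then have "\<exists>\<epsilon>. \<epsilon>\<^sup>2 = 1 \<and> \<epsilon> * s (0, 0) = \<alpha>"
    by (auto simp: power2_eq_iff intro: exI[of _ 1] exI[of _ "-1"])
  then obtain \<epsilon> :: complex where \<epsilon>: "\<epsilon>\<^sup>2 = 1" "\<epsilon> * s (0, 0) = \<alpha>" by blast
  have *: "sqrt_transport (\<lambda>t. f (edge g h t)) (\<epsilon> * s (w 0)) (\<epsilon> * s (w 1))"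
    if "continuous_on {0..1} w" "\<And>t. t \<in> {0..1} \<Longrightarrow> w t \<in> T" "\<And>t. p (w t) = edge g h t"
    for g h and w :: "real \<Rightarrow> real \<times> real"
    unfolding sqrt_transport_def
  proof (intro exI[of _ "\<lambda>t. \<epsilon> * s (w t)"] conjI ballI)
    show "continuous_on {0..1} (\<lambda>t. \<epsilon> * s (w t))"
      by (intro continuous_intros continuous_on_compose2[OF s(1) that(1)]) (use that(2) in auto)
    show "(\<epsilon> * s (w t))\<^sup>2 = f (edge g h t)" if "t \<in> {0..1}" for t
      using s(2)[OF \<open>\<And>t. t \<in> {0..1} \<Longrightarrow> w t \<in> T\<close>[OF that]] \<epsilon>(1)
      by (simp add: power_mult_distrib \<open>\<And>t. p (w t) = edge g h t\<close>)
  qed auto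
  have w: "continuous_on {0..1} (\<lambda>t. (t, 0) :: real \<times> real)"
    "continuous_on {0..1} (\<lambda>t. (0, t) :: real \<times> real)"
    "continuous_on {0..1} (\<lambda>t. (1 - t, t) :: real \<times> real)"
    by (intro continuous_intros)+
  have "sqrt_transport (\<lambda>t. f (edge a b t)) \<alpha> (\<epsilon> * s (1, 0))"
    using *[OF w(1), of a b] \<epsilon>(2) by (auto simp: T_def p_def edge_def)
  moreover have "sqrt_transport (\<lambda>t. f (edge a c t)) \<alpha> (\<epsilon> * s (0, 1))"
    using *[OF w(2), of a c] \<epsilon>(2) by (auto simp: T_def p_def edge_def)
  moreover have "sqrt_transport (\<lambda>t. f (edge b c t)) (\<epsilon> * s (1, 0)) (\<epsilon> * s (0, 1))"
    using *[OF w(3), of b c] by (auto simp: T_def p_def edge_def)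
  ultimately show ?thesis by blast
qed

text \<open>
  Simple connectedness of the \<open>2\<close>-skeleton in the form needed here: the values at the vertices are
  obtained by transport from a base vertex \<open>a\<close>, and the triangle with vertices \<open>a\<close>, \<open>g\<close>, \<open>h\<close> shows that
  they also match along the edge from \<open>g\<close> to \<open>h\<close>.
\<close>

lemma sqrt_potential:
  fixes f :: "point \<Rightarrow> complex"
  assumes lin: "linear_order r"
    and f: "continuous_on (skeleton_on r A) f" "\<And>x. x \<in> skeleton_on r A \<Longrightarrow> f x \<noteq> 0"
  shows "\<exists>q. \<forall>g\<in>A. \<forall>h\<in>A. sqrt_transport (\<lambda>t. f (edge g h t)) (q g) (q h)"
proof (cases "A = {}")
  case False
  then obtain a where a: "a \<in> A" by blast
  have nz: "f (edge g h t) \<noteq> 0" if "t \<in> {0..1}" "g \<in> A" "h \<in> A" for g h t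
    using f(2)[OF edge_in_skeleton[OF lin that(1)], of g h] that by auto
  define \<alpha> where "\<alpha> = csqrt (f (vertex a))"
  have \<alpha>: "\<alpha>\<^sup>2 = f (vertex a)" by (simp add: \<alpha>_def)
  have "\<alpha> \<noteq> 0" using \<alpha> nz[of 0 a a] a by auto
  define q where "q g = (SOME \<beta>. sqrt_transport (\<lambda>t. f (edge a g t)) \<alpha> \<beta>)" for g
  have q: "sqrt_transport (\<lambda>t. f (edge a g t)) \<alpha> (q g)" if "g \<in> A" for g
  proof -
    have "\<exists>\<beta>. sqrt_transport (\<lambda>t. f (edge a g t)) \<alpha> \<beta>"
      using sqrt_transport_triangle[OF lin _ f \<alpha>, of g g] a that by auto
    then show ?thesis unfolding q_def by (rule someI_ex)
  qed
  have uniq: "\<beta> = q g" if "g \<in> A" "sqrt_transport (\<lambda>t. f (edge a g t)) \<alpha> \<beta>" for g \<beta>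
    using sqrt_transport_proportional[OF that(2) q[OF that(1)], of 1] nz[OF _ a that(1)] \<open>\<alpha> \<noteq> 0\<close>
    by auto
  have "sqrt_transport (\<lambda>t. f (edge g h t)) (q g) (q h)" if "g \<in> A" "h \<in> A" for g h
    using sqrt_transport_triangle[OF lin _ f \<alpha>, of g h] uniq a that by auto
  then show ?thesis by blast
qed simp

section \<open>Determinants over abstract permutations\<close>

definition psign :: "'n::finite perm \<Rightarrow> int" where
  "psign g = sign (apply g)"

lemma psign_cases: "psign g = 1 \<or> psign g = -1"
  by (simp add: psign_def sign_def)

lemma psign_swap:
  assumes "a \<noteq> b"
  shows "psign (g * \<langle>a \<leftrightarrow> b\<rangle>) = - psign g"
proof -
  have "permutation (apply h)" for h :: "'a perm"
    by (simp add: permutation)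
  moreover have "sign (apply \<langle>a \<leftrightarrow> b\<rangle>) = -1"
    using assms by (simp add: swap.rep_eq sign_swap_id)
  ultimately show ?thesis
    by (simp add: psign_def apply_times sign_compose)
qed

lemma det_perms:
  fixes M :: "'a::comm_ring_1 ^ 'n ^ 'n"
  shows "det M = (\<Sum>g\<in>UNIV. of_int (psign g) * (\<Prod>j\<in>UNIV. M $ (g \<langle>$\<rangle> j) $ j))"
proof -
  have "bij_betw apply (UNIV :: 'n perm set) {p. p permutes UNIV}"
  proof (rule bij_betw_imageI)
    show "inj_on apply (UNIV :: 'n perm set)" by (simp add: inj_on_def apply_inject)
    have "p \<in> range apply" if "p permutes UNIV" for p :: "'n \<Rightarrow> 'n"
      using that Perm_inverse[of p] by (metis (mono_tags, lifting) finite mem_Collect_eq permutes_bij rangeI)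
    then show "range apply = {p. p permutes (UNIV :: 'n set)}"
      by (auto intro: bij_imp_permutes)
  qed
  then have "(\<Sum>p | p permutes UNIV. of_int (sign p) * (\<Prod>j\<in>UNIV. M $ p j $ j)) =
      (\<Sum>g\<in>UNIV. of_int (psign g) * (\<Prod>j\<in>UNIV. M $ (g \<langle>$\<rangle> j) $ j))"
    unfolding psign_def by (rule sum.reindex_bij_betw[symmetric])
  moreover have "det M = det (transpose M)" by (simp add: det_transpose)
  ultimately show ?thesis by (simp add: det_def transpose_def)
qed

text \<open>A product over \<open>h \<noteq> g\<close> meets a zero, so the expansion has a single term.\<close>

lemma det_monomial:
  fixes M :: "'a::idom ^ 'n ^ 'n"
  assumes "\<And>i j. M $ i $ j \<noteq> 0 \<Longrightarrow> i = g \<langle>$\<rangle> j"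
  shows "det M = of_int (psign g) * (\<Prod>j\<in>UNIV. M $ (g \<langle>$\<rangle> j) $ j)"
proof -
  have "h = g" if "(\<Prod>j\<in>UNIV. M $ (h \<langle>$\<rangle> j) $ j) \<noteq> 0" for h
    using that assms by (intro perm_eqI) auto
  then have "det M = (\<Sum>h\<in>{g}. of_int (psign h) * (\<Prod>j\<in>UNIV. M $ (h \<langle>$\<rangle> j) $ j))"
    unfolding det_perms by (intro sum.mono_neutral_right finite_perms) auto
  then show ?thesis by simp
qed

text \<open>
  If \<open>h\<close> and \<open>g\<close> agree on \<open>{j, k}\<close> as a set, then \<open>g\<inverse>h\<close> preserves \<open>{j, k}\<close> and \<open>{m, n}\<close>, and it can only
  exchange the two elements of each.
\<close>

lemma set_stabilizer_coset:
  fixes g :: S4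
  assumes "distinct [j, k, m, n]" "UNIV = {j, k, m, n}"
  shows "{h. apply h ` {j, k} = apply g ` {j, k}} =
      {g, g * \<langle>j \<leftrightarrow> k\<rangle>, g * \<langle>m \<leftrightarrow> n\<rangle>, g * \<langle>j \<leftrightarrow> k\<rangle> * \<langle>m \<leftrightarrow> n\<rangle>}"
    and "distinct [g, g * \<langle>j \<leftrightarrow> k\<rangle>, g * \<langle>m \<leftrightarrow> n\<rangle>, g * \<langle>j \<leftrightarrow> k\<rangle> * \<langle>m \<leftrightarrow> n\<rangle>]"
proof -
  have all: "(\<forall>c. P c) \<longleftrightarrow> P j \<and> P k \<and> P m \<and> P n" for P
  proof -
    have "(\<forall>c. P c) \<longleftrightarrow> (\<forall>c\<in>UNIV. P c)" by simp
    then show ?thesis unfolding assms(2) by simp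
  qed
  have ne: "j \<noteq> k" "j \<noteq> m" "j \<noteq> n" "k \<noteq> m" "k \<noteq> n" "m \<noteq> n"
    "k \<noteq> j" "m \<noteq> j" "n \<noteq> j" "m \<noteq> k" "n \<noteq> k" "n \<noteq> m"
    using assms(1) by auto
  note eq = perm_eq_iff all apply_mult apply_inj
  have s: "\<langle>j \<leftrightarrow> k\<rangle> \<langle>$\<rangle> j = k" "\<langle>j \<leftrightarrow> k\<rangle> \<langle>$\<rangle> k = j" "\<langle>j \<leftrightarrow> k\<rangle> \<langle>$\<rangle> m = m" "\<langle>j \<leftrightarrow> k\<rangle> \<langle>$\<rangle> n = n"
    "\<langle>m \<leftrightarrow> n\<rangle> \<langle>$\<rangle> j = j" "\<langle>m \<leftrightarrow> n\<rangle> \<langle>$\<rangle> k = k" "\<langle>m \<leftrightarrow> n\<rangle> \<langle>$\<rangle> m = n" "\<langle>m \<leftrightarrow> n\<rangle> \<langle>$\<rangle> n = m"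
    using ne by (simp_all add: swap_sym[of j k] swap_sym[of m n])
  show "distinct [g, g * \<langle>j \<leftrightarrow> k\<rangle>, g * \<langle>m \<leftrightarrow> n\<rangle>, g * \<langle>j \<leftrightarrow> k\<rangle> * \<langle>m \<leftrightarrow> n\<rangle>]"
    using ne by (simp add: eq s)
  have gUNIV: "UNIV = {g \<langle>$\<rangle> j, g \<langle>$\<rangle> k, g \<langle>$\<rangle> m, g \<langle>$\<rangle> n}"
  proof -
    have "UNIV = apply g ` UNIV" using bij_apply[of g] by (simp add: bij_is_surj)
    then show ?thesis unfolding assms(2) by simp
  qed
  show "{h. apply h ` {j, k} = apply g ` {j, k}} =
      {g, g * \<langle>j \<leftrightarrow> k\<rangle>, g * \<langle>m \<leftrightarrow> n\<rangle>, g * \<langle>j \<leftrightarrow> k\<rangle> * \<langle>m \<leftrightarrow> n\<rangle>}" (is "?L = ?R")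
  proof
    show "?R \<subseteq> ?L" by (auto simp: apply_mult s)
    show "?L \<subseteq> ?R"
    proof
      fix h assume "h \<in> ?L"
      then have "h \<langle>$\<rangle> j \<in> {g \<langle>$\<rangle> j, g \<langle>$\<rangle> k}" "h \<langle>$\<rangle> k \<in> {g \<langle>$\<rangle> j, g \<langle>$\<rangle> k}" by auto
      moreover from this have "h \<langle>$\<rangle> m \<in> {g \<langle>$\<rangle> m, g \<langle>$\<rangle> n}" "h \<langle>$\<rangle> n \<in> {g \<langle>$\<rangle> m, g \<langle>$\<rangle> n}"
        using gUNIV ne apply_inj[of h] by (metis UNIV_I insertE insertI1 insertI2 singletonD)+
      moreover have "h \<langle>$\<rangle> j \<noteq> h \<langle>$\<rangle> k" "h \<langle>$\<rangle> m \<noteq> h \<langle>$\<rangle> n" using ne by (simp_all add: apply_inj)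
      ultimately have
        "h \<langle>$\<rangle> j = g \<langle>$\<rangle> j \<and> h \<langle>$\<rangle> k = g \<langle>$\<rangle> k \<or> h \<langle>$\<rangle> j = g \<langle>$\<rangle> k \<and> h \<langle>$\<rangle> k = g \<langle>$\<rangle> j"
        "h \<langle>$\<rangle> m = g \<langle>$\<rangle> m \<and> h \<langle>$\<rangle> n = g \<langle>$\<rangle> n \<or> h \<langle>$\<rangle> m = g \<langle>$\<rangle> n \<and> h \<langle>$\<rangle> n = g \<langle>$\<rangle> m"
        by auto
      then show "h \<in> ?R" by (elim disjE) (simp_all add: eq s)
    qed
  qed
qed

definition minor2 :: "complex ^ 'n ^ 'n \<Rightarrow> 'n \<Rightarrow> 'n \<Rightarrow> 'n \<Rightarrow> 'n \<Rightarrow> complex" where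
  "minor2 M i l j k = M $ i $ j * M $ l $ k - M $ l $ j * M $ i $ k"

text \<open>
  Only permutations of the coset avoid the zeros outside the blocks. Either transposition reverses
  the sign, so the four terms are those of a product of two \<open>2 \<times> 2\<close> determinants.
\<close>

lemma det_two_blocks:
  fixes M :: "complex ^ 4 ^ 4"
  assumes D: "distinct [j, k, m, n]" and U: "UNIV = {j, k, m, n}"
    and block: "\<And>i c. M $ i $ c \<noteq> 0 \<Longrightarrow> i \<in> apply g ` {j, k} \<longleftrightarrow> c \<in> {j, k}"
  shows "det M = of_int (psign g) *
    (minor2 M (g \<langle>$\<rangle> j) (g \<langle>$\<rangle> k) j k * minor2 M (g \<langle>$\<rangle> m) (g \<langle>$\<rangle> n) m n)"
proof -
  let ?a = "\<langle>j \<leftrightarrow> k\<rangle>" and ?b = "\<langle>m \<leftrightarrow> n\<rangle>"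
  let ?t = "\<lambda>h. of_int (psign h) * (\<Prod>c\<in>UNIV. M $ (h \<langle>$\<rangle> c) $ c)"
  note coset = set_stabilizer_coset[OF D U, of g]
  have prod4: "(\<Prod>c\<in>UNIV. f c) = f j * f k * f m * f n" for f :: "4 \<Rightarrow> complex"
    unfolding U using D by (simp add: mult.assoc)
  have "h \<in> {h. apply h ` {j, k} = apply g ` {j, k}}" if "(\<Prod>c\<in>UNIV. M $ (h \<langle>$\<rangle> c) $ c) \<noteq> 0" for h
  proof -
    have "h \<langle>$\<rangle> c \<in> apply g ` {j, k} \<longleftrightarrow> c \<in> {j, k}" for c
      using that block[of "h \<langle>$\<rangle> c" c] by simp
    then have sub: "apply h ` {j, k} \<subseteq> apply g ` {j, k}" by blast
    have "card (apply h ` {j, k}) = card (apply g ` {j, k})"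
      by (simp add: card_insert_if apply_inj)
    then show ?thesis using card_subset_eq[OF _ sub] by simp
  qed
  then have "det M = (\<Sum>h\<in>{h. apply h ` {j, k} = apply g ` {j, k}}. ?t h)"
    unfolding det_perms by (intro sum.mono_neutral_right finite_perms) auto
  also have "\<dots> = ?t g + ?t (g * ?a) + ?t (g * ?b) + ?t (g * ?a * ?b)"
    unfolding coset(1) using coset(2) by (simp add: add.assoc)
  also have "\<dots> = of_int (psign g) *
    (minor2 M (g \<langle>$\<rangle> j) (g \<langle>$\<rangle> k) j k * minor2 M (g \<langle>$\<rangle> m) (g \<langle>$\<rangle> n) m n)"
  proof -
    have "?a \<langle>$\<rangle> k = j" "?b \<langle>$\<rangle> n = m" by (simp_all add: swap_sym[of j k] swap_sym[of m n])
    moreover have "?a \<langle>$\<rangle> m = m" "?a \<langle>$\<rangle> n = n" "?b \<langle>$\<rangle> j = j" "?b \<langle>$\<rangle> k = k" "j \<noteq> k" "m \<noteq> n"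
      using D by auto
    moreover from this have "psign (g * (?a * ?b)) = psign g"
      using psign_swap[of m n "g * ?a"] by (simp add: psign_swap mult.assoc)
    ultimately show ?thesis
      by (simp add: prod4 apply_mult psign_swap minor2_def algebra_simps)
  qed
  finally show ?thesis .
qed

section \<open>Matrix fields with the prescribed block structure\<close>

text \<open>
  The properties of a unitary intertwiner that matter, restricted to the \<open>2\<close>-skeleton. The last
  assumption says that if all vertices of the face carrying \<open>x\<close> send the columns \<open>B\<close> to the rows
  \<open>B'\<close>, then \<open>U x\<close> is zero outside the blocks \<open>B' \<times> B\<close> and \<open>-B' \<times> -B\<close>.
\<close>

locale block_matrix_field =
  fixes r :: "S4 rel" and U :: "point \<Rightarrow> complex ^ 4 ^ 4"
  assumes lin: "linear_order r"
    and cont: "continuous_on (skeleton2 r) U"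
    and det_nz: "x \<in> skeleton2 r \<Longrightarrow> det (U x) \<noteq> 0"
    and block: "x \<in> skeleton2 r \<Longrightarrow> (\<And>g. x g \<noteq> 0 \<Longrightarrow> apply g ` B = B') \<Longrightarrow>
      U x $ i $ j \<noteq> 0 \<Longrightarrow> i \<in> B' \<longleftrightarrow> j \<in> B"
begin

lemma skeleton_on_D: "x \<in> skeleton_on r A \<Longrightarrow> x \<in> skeleton2 r"
  "x \<in> skeleton_on r A \<Longrightarrow> x g \<noteq> 0 \<Longrightarrow> g \<in> A"
  by (auto simp: skeleton_on_def)

lemma continuous_on_entry: "continuous_on (skeleton_on r A) (\<lambda>x. U x $ i $ j)"
  by (intro continuous_intros continuous_on_subset[OF cont]) (auto simp: skeleton_on_def)

lemma column_support:
  assumes "x \<in> skeleton_on r A" "\<And>h. h \<in> A \<Longrightarrow> h \<langle>$\<rangle> j = i" "U x $ l $ j \<noteq> 0"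
  shows "l = i"
  using block[of x "{j}" "{i}" l j] skeleton_on_D[OF assms(1)] assms(2,3) by auto

text \<open>The entry is the only one in its column that can be non-zero, and the determinant is not \<open>0\<close>.\<close>

lemma entry_nonzero:
  assumes "x \<in> skeleton_on r {h. h \<langle>$\<rangle> j = i}"
  shows "U x $ i $ j \<noteq> 0"
proof
  assume "U x $ i $ j = 0"
  then have "column j (U x) = 0"
    using column_support[OF assms] by (auto simp: column_def vec_eq_iff)
  then show False using det_zero_column(2) det_nz skeleton_on_D(1)[OF assms] by blast
qed

lemma edge_entry_nonzero:
  assumes "t \<in> {0..1}" "g \<langle>$\<rangle> j = h \<langle>$\<rangle> j"
  shows "U (edge g h t) $ (h \<langle>$\<rangle> j) $ j \<noteq> 0"
  using assms by (intro entry_nonzero edge_in_skeleton lin) auto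

lemma det_vertex:
  "det (U (vertex h)) = of_int (psign h) * (\<Prod>j\<in>UNIV. U (vertex h) $ (h \<langle>$\<rangle> j) $ j)"
proof (rule det_monomial)
  fix i j assume "U (vertex h) $ i $ j \<noteq> 0"
  then show "i = h \<langle>$\<rangle> j"
    using column_support[of "vertex h" "{h}" j "h \<langle>$\<rangle> j" i] edge_in_skeleton[OF lin, of 0 h h "{h}"]
    by simp
qed

text \<open>
  Without zeros there are roots at the vertices that match along all edges: of the entry \<open>(i, j)\<close> on
  the permutations that send \<open>j\<close> to \<open>i\<close>, and of the determinant on all permutations.
\<close>

lemma entry_roots:
  "\<exists>q. \<forall>g h. g \<langle>$\<rangle> j = i \<longrightarrow> h \<langle>$\<rangle> j = i \<longrightarrow>
    sqrt_transport (\<lambda>t. U (edge g h t) $ i $ j) (q g) (q h)"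
  using sqrt_potential[OF lin continuous_on_entry[of "{h. h \<langle>$\<rangle> j = i}" i j] entry_nonzero[of _ j i]]
  by auto

lemma det_roots: "\<exists>Q. \<forall>g h. sqrt_transport (\<lambda>t. det (U (edge g h t))) (Q g) (Q h)"
proof -
  have "continuous_on (skeleton_on r UNIV) (\<lambda>x. det (U x))"
    unfolding det_def by (intro continuous_intros continuous_on_entry)
  then show ?thesis
    using sqrt_potential[OF lin, of UNIV "\<lambda>x. det (U x)"] det_nz skeleton_on_D(1) by auto
qed

text \<open>
  On an edge whose ends agree on the columns \<open>j\<close> and \<open>k\<close>, these columns have one non-zero entry
  each. So the minor is, up to sign, the product of two entries, and its square root changes along
  the edge by the same factor as those of the entries.
\<close>

lemma minor_ratio:
  assumes q: "\<And>c g h. g \<langle>$\<rangle> c = h \<langle>$\<rangle> c \<Longrightarrow>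
      sqrt_transport (\<lambda>t. U (edge g h t) $ (h \<langle>$\<rangle> c) $ c) (q c g) (q c h)"
    and R: "sqrt_transport (\<lambda>t. minor2 (U (edge g h t)) i l j k) (R g) (R h)"
    and agree: "g \<langle>$\<rangle> j = h \<langle>$\<rangle> j" "g \<langle>$\<rangle> k = h \<langle>$\<rangle> k"
    and jk: "j \<noteq> k" and il: "{h \<langle>$\<rangle> j, h \<langle>$\<rangle> k} = {i, l}"
  shows "R g / (q j g * q k g) = R h / (q j h * q k h)"
proof -
  let ?f = "\<lambda>t. U (edge g h t) $ (h \<langle>$\<rangle> j) $ j * U (edge g h t) $ (h \<langle>$\<rangle> k) $ k"
  have f: "sqrt_transport ?f (q j g * q k g) (q j h * q k h)"
    by (intro sqrt_transport_mult q agree)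
  have nz: "?f t \<noteq> 0" if "t \<in> {0..1}" for t
    using edge_entry_nonzero[OF that] agree by simp
  have hjk: "h \<langle>$\<rangle> j \<noteq> h \<langle>$\<rangle> k" using jk by (simp add: apply_inj)
  have col: "i' = h \<langle>$\<rangle> c"
    if "t \<in> {0..1}" "g \<langle>$\<rangle> c = h \<langle>$\<rangle> c" "U (edge g h t) $ i' $ c \<noteq> 0" for t c i'
    using that(2) by (intro column_support[OF edge_in_skeleton[OF lin that(1) order_refl] _ that(3)]) auto
  have zero: "U (edge g h t) $ (h \<langle>$\<rangle> j) $ k = 0" "U (edge g h t) $ (h \<langle>$\<rangle> k) $ j = 0"
    if "t \<in> {0..1}" for t
    using col[OF that agree(2), of "h \<langle>$\<rangle> j"] col[OF that agree(1), of "h \<langle>$\<rangle> k"] hjk by auto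
  \<comment> \<open>The sign \<open>\<kappa>\<close> depends on whether \<open>h\<close> lists the rows in the order \<open>i\<close>, \<open>l\<close> or \<open>l\<close>, \<open>i\<close>.\<close>
  obtain \<kappa> where "minor2 (U (edge g h t)) i l j k = \<kappa> * ?f t" if "t \<in> {0..1}" for t
  proof (cases "h \<langle>$\<rangle> j = i")
    case True
    then have "l = h \<langle>$\<rangle> k" using il hjk by (auto simp: doubleton_eq_iff)
    then show ?thesis using that[of 1] True zero by (auto simp: minor2_def)
  next
    case False
    then have "l = h \<langle>$\<rangle> j" "i = h \<langle>$\<rangle> k" using il by (auto simp: doubleton_eq_iff)
    then show ?thesis using that[of "-1"] zero by (auto simp: minor2_def)
  qed
  then have "q j g * q k g * R h = R g * (q j h * q k h)"
    using nz by (rule sqrt_transport_proportional[OF f R])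
  moreover have "q c g \<noteq> 0" if "g \<langle>$\<rangle> c = h \<langle>$\<rangle> c" for c
    using sqrt_transport_start[OF q[OF that]] edge_entry_nonzero[of 0 g c h] that by auto
  moreover have "q c h \<noteq> 0" for c
    using sqrt_transport_start[OF q[of h c h]] edge_entry_nonzero[of 0 h c h] by auto
  ultimately show ?thesis using agree by (simp add: field_simps)
qed

lemma det_eq_minors:
  assumes D: "distinct [j, k, m, n]" "UNIV = {j, k, m, n}"
    and x: "x \<in> skeleton_on r {h. apply h ` {j, k} = apply g ` {j, k}}"
  shows "det (U x) = of_int (psign g) *
      (minor2 (U x) (g \<langle>$\<rangle> j) (g \<langle>$\<rangle> k) j k * minor2 (U x) (g \<langle>$\<rangle> m) (g \<langle>$\<rangle> n) m n)"
    and "minor2 (U x) (g \<langle>$\<rangle> j) (g \<langle>$\<rangle> k) j k \<noteq> 0"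
    and "minor2 (U x) (g \<langle>$\<rangle> m) (g \<langle>$\<rangle> n) m n \<noteq> 0"
proof -
  show det: "det (U x) = of_int (psign g) *
      (minor2 (U x) (g \<langle>$\<rangle> j) (g \<langle>$\<rangle> k) j k * minor2 (U x) (g \<langle>$\<rangle> m) (g \<langle>$\<rangle> n) m n)"
  proof (rule det_two_blocks[OF D])
    show "i \<in> apply g ` {j, k} \<longleftrightarrow> c \<in> {j, k}" if "U x $ i $ c \<noteq> 0" for i c
      by (rule block[OF skeleton_on_D(1)[OF x] _ that]) (use skeleton_on_D(2)[OF x] in simp)
  qed
  show "minor2 (U x) (g \<langle>$\<rangle> j) (g \<langle>$\<rangle> k) j k \<noteq> 0" "minor2 (U x) (g \<langle>$\<rangle> m) (g \<langle>$\<rangle> n) m n \<noteq> 0"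
    using det det_nz[OF skeleton_on_D(1)[OF x]] by auto
qed

text \<open>
  On the face spanned by the coset \<open>A\<close> of \<open>g\<close> the determinant is, up to sign, the product of two
  \<open>2 \<times> 2\<close> minors, so \<open>\<epsilon>\<close> is a constant times \<open>\<rho>\<^sub>1 \<cdot> \<rho>\<^sub>2\<close>, where \<open>\<rho>\<^sub>1\<close> and \<open>\<rho>\<^sub>2\<close> compare a square root of
  each minor with those of the entries. As \<open>\<rho>\<^sub>1\<close> depends only on the values at \<open>j\<close> and \<open>k\<close>, and \<open>\<rho>\<^sub>2\<close>
  only on those at \<open>m\<close> and \<open>n\<close>, both sides of the conclusion consist of the same factors.
\<close>

lemma normalized_root_square:
  assumes q: "\<And>c g h. g \<langle>$\<rangle> c = h \<langle>$\<rangle> c \<Longrightarrow>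
      sqrt_transport (\<lambda>t. U (edge g h t) $ (h \<langle>$\<rangle> c) $ c) (q c g) (q c h)"
    and Q: "\<And>g h. sqrt_transport (\<lambda>t. det (U (edge g h t))) (Q g) (Q h)"
    and D: "distinct [j, k, m, n]" "UNIV = {j, k, m, n}"
    and \<epsilon>: "\<And>h. \<epsilon> h = Q h / (\<Prod>c\<in>UNIV. q c h)"
  shows "\<epsilon> g * \<epsilon> (g * \<langle>j \<leftrightarrow> k\<rangle> * \<langle>m \<leftrightarrow> n\<rangle>) = \<epsilon> (g * \<langle>j \<leftrightarrow> k\<rangle>) * \<epsilon> (g * \<langle>m \<leftrightarrow> n\<rangle>)"
proof -
  let ?a = "\<langle>j \<leftrightarrow> k\<rangle>" and ?b = "\<langle>m \<leftrightarrow> n\<rangle>"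
  define A where "A = {h. apply h ` {j, k} = apply g ` {j, k}}"
  let ?\<delta>\<^sub>1 = "\<lambda>x. minor2 (U x) (g \<langle>$\<rangle> j) (g \<langle>$\<rangle> k) j k"
  let ?\<delta>\<^sub>2 = "\<lambda>x. minor2 (U x) (g \<langle>$\<rangle> m) (g \<langle>$\<rangle> n) m n"
  note minors = det_eq_minors[OF D, of _ g, folded A_def]
  have cont\<^sub>1: "continuous_on (skeleton_on r A) ?\<delta>\<^sub>1" and cont\<^sub>2: "continuous_on (skeleton_on r A) ?\<delta>\<^sub>2"
    unfolding minor2_def by (intro continuous_intros continuous_on_entry)+
  obtain R\<^sub>1 where "\<forall>g\<in>A. \<forall>h\<in>A. sqrt_transport (\<lambda>t. ?\<delta>\<^sub>1 (edge g h t)) (R\<^sub>1 g) (R\<^sub>1 h)"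
    using sqrt_potential[where f = ?\<delta>\<^sub>1, OF lin cont\<^sub>1] minors(2) by auto
  then have R\<^sub>1: "sqrt_transport (\<lambda>t. ?\<delta>\<^sub>1 (edge g' h t)) (R\<^sub>1 g') (R\<^sub>1 h)"
    if "g' \<in> A" "h \<in> A" for g' h using that by simp
  obtain R\<^sub>2 where "\<forall>g\<in>A. \<forall>h\<in>A. sqrt_transport (\<lambda>t. ?\<delta>\<^sub>2 (edge g h t)) (R\<^sub>2 g) (R\<^sub>2 h)"
    using sqrt_potential[where f = ?\<delta>\<^sub>2, OF lin cont\<^sub>2] minors(3) by auto
  then have R\<^sub>2: "sqrt_transport (\<lambda>t. ?\<delta>\<^sub>2 (edge g' h t)) (R\<^sub>2 g') (R\<^sub>2 h)"
    if "g' \<in> A" "h \<in> A" for g' h using that by simp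
  define \<rho>\<^sub>1 where "\<rho>\<^sub>1 h = R\<^sub>1 h / (q j h * q k h)" for h
  define \<rho>\<^sub>2 where "\<rho>\<^sub>2 h = R\<^sub>2 h / (q m h * q n h)" for h
  have A: "A = {g, g * ?a, g * ?b, g * ?a * ?b}"
    unfolding A_def by (rule set_stabilizer_coset[OF D])
  have swaps: "?a \<langle>$\<rangle> j = k" "?a \<langle>$\<rangle> k = j" "?a \<langle>$\<rangle> m = m" "?a \<langle>$\<rangle> n = n"
    "?b \<langle>$\<rangle> j = j" "?b \<langle>$\<rangle> k = k" "?b \<langle>$\<rangle> m = n" "?b \<langle>$\<rangle> n = m" "j \<noteq> k" "m \<noteq> n"
    using D(1) by auto
  have rows: "{h \<langle>$\<rangle> j, h \<langle>$\<rangle> k} = {g \<langle>$\<rangle> j, g \<langle>$\<rangle> k}" "{h \<langle>$\<rangle> m, h \<langle>$\<rangle> n} = {g \<langle>$\<rangle> m, g \<langle>$\<rangle> n}"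
    if "h \<in> A" for h using that by (auto simp: A apply_mult swaps)
  have \<rho>\<^sub>1: "\<rho>\<^sub>1 h = \<rho>\<^sub>1 h'"
    if "h \<in> A" "h' \<in> A" "h \<langle>$\<rangle> j = h' \<langle>$\<rangle> j" "h \<langle>$\<rangle> k = h' \<langle>$\<rangle> k" for h h'
    unfolding \<rho>\<^sub>1_def
    by (rule minor_ratio[where q = q and R = R\<^sub>1, OF q R\<^sub>1[OF that(1,2)] that(3,4) swaps(9) rows(1)[OF that(2)]])
  have \<rho>\<^sub>2: "\<rho>\<^sub>2 h = \<rho>\<^sub>2 h'"
    if "h \<in> A" "h' \<in> A" "h \<langle>$\<rangle> m = h' \<langle>$\<rangle> m" "h \<langle>$\<rangle> n = h' \<langle>$\<rangle> n" for h h'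
    unfolding \<rho>\<^sub>2_def
    by (rule minor_ratio[where q = q and R = R\<^sub>2, OF q R\<^sub>2[OF that(1,2)] that(3,4) swaps(10) rows(2)[OF that(2)]])
  have rho: "\<rho>\<^sub>1 (g * ?b) = \<rho>\<^sub>1 g" "\<rho>\<^sub>1 (g * ?a * ?b) = \<rho>\<^sub>1 (g * ?a)"
    by (rule \<rho>\<^sub>1; simp add: A apply_mult swaps)+
  have rho': "\<rho>\<^sub>2 (g * ?a) = \<rho>\<^sub>2 g" "\<rho>\<^sub>2 (g * ?a * ?b) = \<rho>\<^sub>2 (g * ?b)"
    by (rule \<rho>\<^sub>2; simp add: A apply_mult swaps)+
  have "\<exists>C. \<forall>h\<in>A. \<epsilon> h = C * (\<rho>\<^sub>1 h * \<rho>\<^sub>2 h)"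
  proof (intro exI ballI)
    fix h assume h: "h \<in> A"
    have g: "g \<in> A" by (simp add: A)
    have "R\<^sub>1 g * R\<^sub>2 g * Q h = Q g * (R\<^sub>1 h * R\<^sub>2 h)"
    proof (rule sqrt_transport_proportional[OF sqrt_transport_mult[OF R\<^sub>1[OF g h] R\<^sub>2[OF g h]] Q])
      fix t :: real assume "t \<in> {0..1}"
      then have "edge g h t \<in> skeleton_on r A" using g h by (intro edge_in_skeleton lin) auto
      then show "det (U (edge g h t)) = of_int (psign g) * (?\<delta>\<^sub>1 (edge g h t) * ?\<delta>\<^sub>2 (edge g h t))"
        and "?\<delta>\<^sub>1 (edge g h t) * ?\<delta>\<^sub>2 (edge g h t) \<noteq> 0"
        using minors by auto
    qed
    note ratio = this
    have "vertex g \<in> skeleton_on r A"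
      using edge_in_skeleton[OF lin, of 0 g g A] g by simp
    then have "R\<^sub>1 g \<noteq> 0" "R\<^sub>2 g \<noteq> 0"
      using sqrt_transport_start[OF R\<^sub>1[OF g g]] sqrt_transport_start[OF R\<^sub>2[OF g g]] minors(2,3)
      by auto
    with ratio have "Q h = Q g / (R\<^sub>1 g * R\<^sub>2 g) * (R\<^sub>1 h * R\<^sub>2 h)"
      by (simp add: field_simps)
    moreover have "(\<Prod>c\<in>UNIV. q c h) = q j h * q k h * (q m h * q n h)"
      unfolding D(2) using D(1) by (simp add: mult.assoc)
    ultimately show "\<epsilon> h = Q g / (R\<^sub>1 g * R\<^sub>2 g) * (\<rho>\<^sub>1 h * \<rho>\<^sub>2 h)"
      by (simp add: \<epsilon> \<rho>\<^sub>1_def \<rho>\<^sub>2_def)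
  qed
  then obtain C where "\<And>h. h \<in> A \<Longrightarrow> \<epsilon> h = C * (\<rho>\<^sub>1 h * \<rho>\<^sub>2 h)" by blast
  then show ?thesis using rho rho' by (simp add: A)
qed

end

section \<open>The sign has no square root compatible with commuting transpositions\<close>

lemma ex_perm_pair:
  assumes "a \<noteq> (b::'a)" "i \<noteq> l"
  shows "\<exists>g. g \<langle>$\<rangle> a = i \<and> g \<langle>$\<rangle> b = l"
proof -
  let ?g = "\<langle>a \<leftrightarrow> i\<rangle>"
  have "i \<noteq> ?g \<langle>$\<rangle> b"
    using apply_inj[of ?g b a] assms(1) unfolding apply_swap_simp by metis
  then have "\<langle>?g \<langle>$\<rangle> b \<leftrightarrow> l\<rangle> \<langle>$\<rangle> i = i" using assms(2) by (rule apply_swap_same)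
  then show ?thesis
    by (intro exI[of _ "\<langle>?g \<langle>$\<rangle> b \<leftrightarrow> l\<rangle> * ?g"]) (auto simp: apply_mult)
qed

text \<open>
  Multiplying \<open>\<epsilon>\<close> by \<open>\<i>\<close> on odd permutations gives a function \<open>e\<close> with values \<open>\<plusminus>1\<close> whose product over
  every coset of a four-group \<open>\<langle>(j k), (m n)\<rangle>\<close> is \<open>-1\<close>. Nine such cosets cover every permutation an
  even number of times, namely \<open>{h. h{1, j} = B}\<close> for \<open>j \<noteq> 1\<close> and two-element sets \<open>B\<close> that avoid \<open>4\<close>:
  if \<open>h(1) = 4\<close>, then \<open>h\<close> lies in none of them, and otherwise in those with \<open>j \<noteq> 1\<close> and \<open>h(j) \<noteq> 4\<close>,
  two in number. So the product over all nine is both \<open>1\<close> and \<open>(-1)\<^sup>9\<close>.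
\<close>

lemma no_square_compatible_root_of_sign:
  fixes \<epsilon> :: "S4 \<Rightarrow> complex"
  assumes root: "\<And>h. (\<epsilon> h)\<^sup>2 = of_int (psign h)"
    and square: "\<And>g j k m n. distinct [j, k, m, n] \<Longrightarrow> UNIV = {j, k, m, n} \<Longrightarrow>
      \<epsilon> g * \<epsilon> (g * \<langle>j \<leftrightarrow> k\<rangle> * \<langle>m \<leftrightarrow> n\<rangle>) = \<epsilon> (g * \<langle>j \<leftrightarrow> k\<rangle>) * \<epsilon> (g * \<langle>m \<leftrightarrow> n\<rangle>)"
  shows False
proof -
  define e where "e h = (if psign h = 1 then \<epsilon> h else \<i> * \<epsilon> h)" for h
  have e2: "(e h)\<^sup>2 = 1" for h
    using psign_cases[of h] by (auto simp: e_def root power_mult_distrib)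
  define J where "J = UNIV - {1::4}"
  define E where "E = {B. B \<subseteq> UNIV - {4::4} \<and> card B = 2}"
  have coset: "(\<Prod>h | apply h ` {1, j} = B. e h) = -1" if j: "j \<in> J" and B: "B \<in> E" for j B
  proof -
    obtain i l where il: "B = {i, l}" "i \<noteq> l" using B by (auto simp: E_def card_2_iff)
    obtain g where g: "g \<langle>$\<rangle> 1 = i" "g \<langle>$\<rangle> j = l" using ex_perm_pair[of 1 j i l] il j by (auto simp: J_def)
    have "card (UNIV - {1, j}) = 2" using j by (simp add: card_Diff_subset J_def)
    then obtain m n where mn: "UNIV - {1, j} = {m, n}" "m \<noteq> n" by (auto simp: card_2_iff)
    have D: "distinct [1, j, m, n]" using mn j by (auto simp: J_def)
    have U: "UNIV = {1, j, m, n}" using mn by blast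
    let ?a = "\<langle>1 \<leftrightarrow> j\<rangle>" and ?b = "\<langle>m \<leftrightarrow> n\<rangle>"
    have ps: "psign (g * ?a) = - psign g" "psign (g * ?b) = - psign g" "psign (g * ?a * ?b) = psign g"
      using psign_swap[of 1 j g] psign_swap[of m n g] psign_swap[of m n "g * ?a"] D
      by (simp_all del: mult.assoc)
    have "(\<Prod>h | apply h ` {1, j} = B. e h) = (\<Prod>h\<in>{g, g * ?a, g * ?b, g * ?a * ?b}. e h)"
      using set_stabilizer_coset(1)[OF D U, of g] by (simp add: il g)
    also have "\<dots> = e g * e (g * ?a * ?b) * (e (g * ?a) * e (g * ?b))"
      using set_stabilizer_coset(2)[OF D U, of g] by (simp add: ac_simps)
    also have "\<dots> = - ((\<epsilon> g * \<epsilon> (g * ?a * ?b)) * (\<epsilon> (g * ?a) * \<epsilon> (g * ?b)))"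
      using psign_cases[of g] by (auto simp: e_def ps) (simp_all add: ac_simps)
    also have "\<dots> = - ((\<epsilon> g * \<epsilon> (g * ?a * ?b))\<^sup>2)"
      using square[OF D U, of g] by (simp add: power2_eq_square)
    also have "\<dots> = -1"
      using psign_cases[of g] unfolding power_mult_distrib root ps by auto
    finally show ?thesis .
  qed
  have "card J = 3" by (simp add: J_def card_Diff_subset)
  moreover have "card E = 3"
  proof -
    have "card E = card (UNIV - {4::4}) choose 2" unfolding E_def by (intro n_subsets) simp
    then show ?thesis by (simp add: card_Diff_subset choose_two)
  qed
  ultimately have "card (J \<times> E) = 9" by (simp add: card_cartesian_product)
  moreover have "(\<Prod>p\<in>J \<times> E. \<Prod>h | apply h ` {1, fst p} = snd p. e h) = (\<Prod>p\<in>J \<times> E. -1)"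
    using coset by (intro prod.cong) auto
  ultimately have "(\<Prod>p\<in>J \<times> E. \<Prod>h | apply h ` {1, fst p} = snd p. e h) = -1" by simp
  moreover have "(\<Prod>p\<in>J \<times> E. \<Prod>h | apply h ` {1, fst p} = snd p. e h) =
      (\<Prod>h\<in>UNIV. \<Prod>p | p \<in> J \<times> E \<and> apply h ` {1, fst p} = snd p. e h)"
    using prod.swap_restrict[of "J \<times> E" UNIV "\<lambda>p h. e h" "\<lambda>p h. apply h ` {1, fst p} = snd p"]
    by (simp add: finite_perms)
  moreover have "(\<Prod>p | p \<in> J \<times> E \<and> apply h ` {1, fst p} = snd p. e h) = 1" for h
  proof -
    let ?S = "{p \<in> J \<times> E. apply h ` {1, fst p} = snd p}"
    have "card ?S = card {j \<in> J. apply h ` {1, j} \<in> E}"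
      by (rule bij_betw_same_card[of fst]) (auto simp: bij_betw_def inj_on_def image_iff)
    moreover have "{j \<in> J. apply h ` {1, j} \<in> E} =
        (if h \<langle>$\<rangle> 1 = 4 then {} else J - {inverse h \<langle>$\<rangle> 4})"
    proof -
      have "card {h \<langle>$\<rangle> 1, h \<langle>$\<rangle> j} = 2" if "j \<noteq> 1" for j
        using that apply_inj[of h 1 j] by (simp add: card_insert_if)
      then have "apply h ` {1, j} \<in> E \<longleftrightarrow> h \<langle>$\<rangle> 1 \<noteq> 4 \<and> h \<langle>$\<rangle> j \<noteq> 4" if "j \<in> J" for j
        using that by (auto simp: E_def J_def)
      moreover have "h \<langle>$\<rangle> j = 4 \<longleftrightarrow> j = inverse h \<langle>$\<rangle> 4" for j
        by (metis apply_inverse_cancel)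
      ultimately show ?thesis by auto
    qed
    moreover have "inverse h \<langle>$\<rangle> 4 \<in> J" if "h \<langle>$\<rangle> 1 \<noteq> 4"
      using that apply_inverse_cancel(2)[of h 4] by (auto simp: J_def)
    ultimately have "card ?S = 0 \<or> card ?S = 2"
      using \<open>card J = 3\<close> by (auto simp: card_Diff_singleton)
    then have "e h ^ card ?S = 1" by (elim disjE) (simp_all only: power_0 e2)
    then show ?thesis by (simp only: prod_constant)
  qed
  ultimately show False by simp
qed

text \<open>
  At a vertex \<open>h\<close> the matrix is monomial, so its determinant is \<open>psign h\<close> times the product of its
  non-zero entries. Hence \<open>\<epsilon>\<close>, a root of the determinant divided by roots of the entries, is a square
  root of the sign.
\<close>

lemma (in block_matrix_field) inconsistent: False
proof -
  define q where "q i j = (SOME q. \<forall>g h. g \<langle>$\<rangle> j = i \<longrightarrow> h \<langle>$\<rangle> j = i \<longrightarrow>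
    sqrt_transport (\<lambda>t. U (edge g h t) $ i $ j) (q g) (q h))" for i j
  have q: "sqrt_transport (\<lambda>t. U (edge g h t) $ i $ j) (q i j g) (q i j h)"
    if "g \<langle>$\<rangle> j = i" "h \<langle>$\<rangle> j = i" for i j g h
    using someI_ex[OF entry_roots[of j i]] that unfolding q_def by simp
  obtain Q where "\<forall>g h. sqrt_transport (\<lambda>t. det (U (edge g h t))) (Q g) (Q h)"
    using det_roots by (elim exE)
  then have Q: "sqrt_transport (\<lambda>t. det (U (edge g h t))) (Q g) (Q h)" for g h by simp
  define p where "p j h = q (h \<langle>$\<rangle> j) j h" for j h
  have p: "sqrt_transport (\<lambda>t. U (edge g h t) $ (h \<langle>$\<rangle> j) $ j) (p j g) (p j h)"
    if "g \<langle>$\<rangle> j = h \<langle>$\<rangle> j" for g h j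
    using q[OF that refl] that by (simp add: p_def)
  define \<epsilon> where "\<epsilon> h = Q h / (\<Prod>j\<in>UNIV. p j h)" for h
  show False
  proof (rule no_square_compatible_root_of_sign)
    show "(\<epsilon> h)\<^sup>2 = of_int (psign h)" for h
    proof -
      have "(p j h)\<^sup>2 = U (vertex h) $ (h \<langle>$\<rangle> j) $ j" for j
        using sqrt_transport_start[OF p[of h j h]] by simp
      moreover have "U (vertex h) $ (h \<langle>$\<rangle> j) $ j \<noteq> 0" for j
        using edge_entry_nonzero[of 0 h j h] by simp
      moreover have "(Q h)\<^sup>2 = det (U (vertex h))"
        using sqrt_transport_start[OF Q[of h h]] by simp
      ultimately show ?thesis
        by (simp add: \<epsilon>_def power_divide det_vertex prod_power_distrib)
    qed
    show "\<epsilon> g * \<epsilon> (g * \<langle>j \<leftrightarrow> k\<rangle> * \<langle>m \<leftrightarrow> n\<rangle>) = \<epsilon> (g * \<langle>j \<leftrightarrow> k\<rangle>) * \<epsilon> (g * \<langle>m \<leftrightarrow> n\<rangle>)"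
      if "distinct [j, k, m, n]" "UNIV = {j, k, m, n}" for g j k m n
      by (rule normalized_root_square[OF p Q that \<epsilon>_def])
  qed
qed

section \<open>Unitary equivalence\<close>

text \<open>
  A generator \<open>g\<inverse>h\<close> stabilizes \<open>B\<close>, as \<open>h\<close> maps \<open>B\<close> to \<open>B'\<close> and \<open>g\<inverse>\<close> maps \<open>B'\<close> back.
\<close>

lemma difference_group_preserves:
  assumes "\<And>g. g \<in> A \<Longrightarrow> apply g ` B = B'" "k \<in> difference_group A"
  shows "k \<langle>$\<rangle> i \<in> B \<longleftrightarrow> i \<in> B"
proof -
  have move: "inverse g \<langle>$\<rangle> y \<in> B \<longleftrightarrow> y \<in> apply g ` B" for g :: S4 and y
    using apply_image_eq_iff[of g "inverse g \<langle>$\<rangle> y" B] by (simp add: apply_inverse_cancel)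
  have difference: "(inverse g * h) \<langle>$\<rangle> i \<in> B \<longleftrightarrow> i \<in> B" if "g \<in> A" "h \<in> A" for g h i
    using assms(1)[OF that(1)] assms(1)[OF that(2)] apply_image_eq_iff[of h i B]
    by (simp add: apply_mult move)
  show ?thesis
    using assms(2) unfolding difference_group_def
  proof (induction arbitrary: i rule: generate.induct)
    case (incl k)
    then show ?case using difference by blast
  next
    case (inv k)
    then obtain g h where "g \<in> A" "h \<in> A" "k = inverse g * h" by blast
    then show ?case using difference[of h g i] by simp
  qed (simp_all add: apply_mult)
qed

lemma unitary_imp_det_nonzero:
  assumes "M \<in> unitary_matrices"
  shows "det M \<noteq> 0"
  using assms unfolding unitary_matrices_def invertible_det_nz[symmetric] invertible_def by blast

text \<open>
  A non-zero entry \<open>(i, j)\<close> forces \<open>[x, g\<inverse>(i)] = [x, j]\<close> for a coordinate \<open>g\<close> exceeding \<open>1/4\<close>. So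
  the group of differences links \<open>g\<inverse>(i)\<close> to \<open>j\<close>, which is the block condition.
\<close>

lemma not_unitarily_equivalent_systems:
  assumes lin: "linear_order r"
  shows "\<not> unitarily_equivalent (X_space r) (system_sigma r) (system_tau r)"
proof
  assume "unitarily_equivalent (X_space r) (system_sigma r) (system_tau r)"
  then obtain u where u: "continuous_map (X_space r) (top_of_set unitary_matrices) u"
    and supp: "\<forall>x \<in> topspace (X_space r). \<forall>i j. u x $ i $ j \<noteq> 0 \<longrightarrow>
      system_tau r i x = system_sigma r j x"
    unfolding unitarily_equivalent_def by blast
  have "continuous_map (top_of_set (skeleton2 r)) (X_space r) Inl"
    unfolding continuous_map_def
  proof (intro conjI allI impI)
    fix W assume W: "openin (X_space r) W"
    then have "Inl -` W \<subseteq> skeleton2 r"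
      by (auto simp: X_space_def openin_binary_sum_topology)
    then have "{x \<in> topspace (top_of_set (skeleton2 r)). Inl x \<in> W} = Inl -` W" by auto
    then show "openin (top_of_set (skeleton2 r)) {x \<in> topspace (top_of_set (skeleton2 r)). Inl x \<in> W}"
      using W by (simp add: X_space_def openin_binary_sum_topology)
  qed (auto simp: X_space_def)
  from continuous_map_compose[OF this u]
  have cont: "continuous_on (skeleton2 r) (\<lambda>x. u (Inl x))"
    and unitary: "\<And>x. x \<in> skeleton2 r \<Longrightarrow> u (Inl x) \<in> unitary_matrices"
    by (auto simp: continuous_map_in_subtopology comp_def image_subset_iff Pi_iff)
  interpret block_matrix_field r "\<lambda>x. u (Inl x)"
  proof
    fix x B B' i j
    assume x: "x \<in> skeleton2 r" and B: "\<And>g. x g \<noteq> 0 \<Longrightarrow> apply g ` B = B'"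
      and nz: "u (Inl x) $ i $ j \<noteq> 0"
    have "system_tau r i (Inl x) = system_sigma r j (Inl x)"
      using supp nz x by (auto simp: X_space_def)
    then have tau: "tau_tilde r i x = cls r x j"
      by (simp add: system_tau_def system_sigma_def sigma_tilde_def)
    obtain g where g: "1/4 < x g" using ex_large_coordinate[OF lin x] by blast
    then have "cls r x (inverse g \<langle>$\<rangle> i) = cls r x j"
      using tau tau_tilde_eq[OF lin, of x g i] x by (simp add: V_domain_def)
    then obtain k where k: "k \<in> difference_group (heavy x)" "k \<langle>$\<rangle> (inverse g \<langle>$\<rangle> i) = j"
      using cls_eq_iff[OF lin x] by blast
    have "apply h ` B = B'" if "h \<in> heavy x" for h using that B[of h] by (auto simp: heavy_def)
    from difference_group_preserves[OF this k(1)] k(2)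
    have "j \<in> B \<longleftrightarrow> inverse g \<langle>$\<rangle> i \<in> B" by metis
    also have "\<dots> \<longleftrightarrow> i \<in> apply g ` B"
      using apply_image_eq_iff[of g "inverse g \<langle>$\<rangle> i" B] by (simp add: apply_inverse_cancel)
    also have "\<dots> \<longleftrightarrow> i \<in> B'" using B[of g] g by simp
    finally show "i \<in> B' \<longleftrightarrow> j \<in> B" ..
  qed (use lin cont unitary_imp_det_nonzero[OF unitary] in auto)
  show False by (rule inconsistent)
qed

theorem theorem6p5:
  fixes r :: "S4 rel"
  assumes "linear_order r"
  shows "piecewise_equivalent (X_space r) (system_sigma r) (system_tau r) \<and>
    \<not> unitarily_equivalent (X_space r) (system_sigma r) (system_tau r)"
  using piecewise_equivalent_systems[OF assms] not_unitarily_equivalent_systems[OF assms] by blast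

end
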